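(* Let $n\ge 1$ and let $v=(v_1,\dots,v_n)$ be a vector of positive integers. Then there exists an $n\times n$ alternating sign matrix whose weighted projection is $v$ if and only if $v \preceq (n,n-1,\dots,2,1)$.
   Context: An alternating sign matrix (ASM) is a square $(0,1,-1)$-matrix in which, in each row and each column, the nonzero entries alternate in sign and sum to $1$. For an $n\times n$ ASM $A$, its weighted projection is the row vector $v(A)=z_n^T A$, where $z_n=(n,n-1,\dots,2,1)^T$. A vector $x=(x_1,\dots,x_n)$ is majorized by $y=(y_1,\dots,y_n)$, written $x\preceq y$, if for every $k=1,\dots,n$ we have $\sum_{i=1}^k x^{\downarrow}_i \le \sum_{i=1}^k y^{\downarrow}_i$, with equality for $k=n$, where $x^{\downarrow}_i$ denotes the $i$-th largest entry of $x$ (and similarly for $y$). *)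

theory Defs
  imports "Jordan_Normal_Form.Matrix"
begin

text \<open>The nonzero entries of a vector, read in order of increasing index.\<close>

definition nonzero_entries :: "int vec \<Rightarrow> int list" where
  "nonzero_entries u = filter (\<lambda>a. a \<noteq> 0) (list_of_vec u)"

definition alternating_sum_one :: "int vec \<Rightarrow> bool" where
  "alternating_sum_one u \<longleftrightarrow>
     successively (\<lambda>a b. sgn b = - sgn a) (nonzero_entries u) \<and>
     sum_list (nonzero_entries u) = 1"

definition alternating_sign_matrix :: "nat \<Rightarrow> int mat \<Rightarrow> bool" where
  "alternating_sign_matrix n A \<longleftrightarrow>
     A \<in> carrier_mat n n \<and>
     (\<forall>i<n. \<forall>j<n. A $$ (i, j) \<in> {0, 1, -1}) \<and>
     (\<forall>i<n. alternating_sum_one (row A i)) \<and>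
     (\<forall>j<n. alternating_sum_one (col A j))"

text \<open>Indices start at 0, so the entries of \<open>zvec n\<close> are \<open>n, n - 1, \<dots>, 2, 1\<close>.\<close>

definition zvec :: "nat \<Rightarrow> int vec" where
  "zvec n = vec n (\<lambda>i. int n - int i)"

text \<open>The library does not distinguish row from column vectors, so the row vector \<open>z\<^sup>T A\<close> is
  written as \<open>A\<^sup>T z\<close>.\<close>

definition weighted_projection :: "int mat \<Rightarrow> int vec" where
  "weighted_projection A = transpose_mat A *\<^sub>v zvec (dim_row A)"

definition decreasing_entries :: "'a::linorder vec \<Rightarrow> 'a list" where
  "decreasing_entries x = rev (sort (list_of_vec x))"

definition majorized :: "'a::{linorder, comm_monoid_add} vec \<Rightarrow> 'a vec \<Rightarrow> bool"
    (infix "\<preceq>\<^sub>m" 50) where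
  "x \<preceq>\<^sub>m y \<longleftrightarrow>
     dim_vec x = dim_vec y \<and>
     (\<forall>k\<in>{1..dim_vec x}.
        (\<Sum>i<k. decreasing_entries x ! i) \<le> (\<Sum>i<k. decreasing_entries y ! i)) \<and>
     (\<Sum>i<dim_vec x. decreasing_entries x ! i) = (\<Sum>i<dim_vec x. decreasing_entries y ! i)"

end

(* Since z weights row r of A by n - r, the projection of A is the sum of the partial sums
   C_0, ..., C_n of its rows, where C_i adds up the first i rows. For an ASM each C_i is a 0/1
   vector with i ones, so k entries of the projection sum to at most the sum of min(i, k) over i,
   which gives majorization. Conversely, majorization allows one to reach v as the column sums of
   some 0/1 vectors C_0, ..., C_n with i ones in C_i, starting from the triangular choice and moving
   ones to other columns. The differences C_(i+1) - C_i need not alternate yet. Their prefix sums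
   are made 0 or 1 by repeatedly replacing the prefix sums x, y of two consecutive C_i by
   floor((x + y)/2), ceil((x + y)/2), which does not change the sum of all C_i. *)
theory Submission
  imports Defs "HOL-Combinatorics.Permutations"
begin

section \<open>0/1 rows with prescribed column sums\<close>

definition binary_rows :: "nat \<Rightarrow> (nat \<Rightarrow> nat \<Rightarrow> int) \<Rightarrow> bool" where
  "binary_rows n C \<longleftrightarrow>
     (\<forall>i\<le>n. \<forall>j<n. C i j \<in> {0, 1}) \<and> (\<forall>i\<le>n. (\<Sum>j<n. C i j) = int i)"

text \<open>Double count of the ones in the first \<open>k\<close> columns of the triangular array
  \<open>of_bool (l < i)\<close>: row \<open>i\<close> has \<open>min i k\<close> of them, column
  \<open>l\<close> has \<open>n - l\<close>.\<close>

lemma sum_min_eq: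
  assumes "k \<le> n"
  shows "(\<Sum>i\<le>n. min (int i) (int k)) = (\<Sum>l<k. int n - int l)"
  using assms
proof (induction k)
  case (Suc k)
  have "(\<Sum>i\<le>n. min (int i) (int (Suc k))) = (\<Sum>i\<le>n. min (int i) (int k) + of_bool (k < i))"
    by (intro sum.cong) auto
  also have "\<dots> = (\<Sum>i\<le>n. min (int i) (int k)) + int (card {i. i \<le> n \<and> k < i})"
    by (simp add: sum.distrib of_bool_def sum.If_cases Int_def)
  also have "{i. i \<le> n \<and> k < i} = {k<..n}" by auto
  finally show ?case using Suc by simp
qed simp

text \<open>As column \<open>p\<close> has the larger sum, some row has a one in column
  \<open>p\<close> and a zero in column \<open>q\<close>. Swapping these two entries keeps the row
  sum.\<close>

lemma binary_rows_exchange: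
  assumes C: "binary_rows n C" and pq: "p < n" "q < n"
    and less: "(\<Sum>i\<le>n. C i q) < (\<Sum>i\<le>n. C i p)"
  obtains C' where "binary_rows n C'"
    "\<And>j. (\<Sum>i\<le>n. C' i j) = (\<Sum>i\<le>n. C i j) + (of_bool (j = q) - of_bool (j = p))"
proof -
  obtain i where i: "i \<le> n" "C i q < C i p"
    using less by (metis atMost_iff leI linorder_not_le sum_mono)
  have "C i q \<in> {0, 1}" "C i p \<in> {0, 1}"
    using C pq i by (simp_all add: binary_rows_def)
  with i have Ci: "C i q = 0" "C i p = 1" by auto
  define C' where "C' r j = C r j + of_bool (r = i) * (of_bool (j = q) - of_bool (j = p))" for r j
  show thesis
  proof
    show "binary_rows n C'"
      unfolding binary_rows_def
    proof (intro conjI allI impI)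
      fix r j assume "r \<le> n" "j < n"
      then have "C r j \<in> {0, 1}" using C by (auto simp: binary_rows_def)
      then show "C' r j \<in> {0, 1}"
        using Ci by (auto simp: C'_def)
    next
      fix r assume "r \<le> n"
      have "(\<Sum>j<n. C' r j) = (\<Sum>j<n. C r j)
          + of_bool (r = i) * ((\<Sum>j<n. of_bool (j = q)) - (\<Sum>j<n. of_bool (j = p)))"
        by (simp add: C'_def sum.distrib sum_distrib_left sum_subtractf right_diff_distrib)
      then show "(\<Sum>j<n. C' r j) = int r"
        using C \<open>r \<le> n\<close> pq by (simp add: binary_rows_def of_bool_def)
    qed
    show "(\<Sum>r\<le>n. C' r j) = (\<Sum>r\<le>n. C r j) + (of_bool (j = q) - of_bool (j = p))" for j
      using i by (simp add: C'_def sum.distrib flip: sum_distrib_right)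
  qed
qed

text \<open>Take the first index \<open>p\<close> at which the prefix sums of the column sums \<open>w\<close> exceed those of
  \<open>u\<close>, and the first later \<open>q\<close> after which they agree again. Then
  \<open>w p > u p \<ge> u q > w q\<close>, so a one can be moved from column \<open>p\<close> to column \<open>q\<close>.\<close>

lemma binary_rows_reach:
  fixes u :: "nat \<Rightarrow> int"
  assumes anti: "\<And>i j. i \<le> j \<Longrightarrow> j < n \<Longrightarrow> u j \<le> u i"
    and C: "binary_rows n C"
    and dom: "\<And>k. k \<le> n \<Longrightarrow> (\<Sum>j<k. u j) \<le> (\<Sum>j<k. \<Sum>i\<le>n. C i j)"
    and total: "(\<Sum>j<n. u j) = (\<Sum>j<n. \<Sum>i\<le>n. C i j)"
  shows "\<exists>C'. binary_rows n C' \<and> (\<forall>j<n. (\<Sum>i\<le>n. C' i j) = u j)"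
  using C dom total
\<comment> \<open>The measure is the total excess of the prefix sums of the column sums over those
  of \<open>u\<close>. Moving a one from \<open>p\<close> to \<open>q\<close> lowers it by
  \<open>q - p\<close>.\<close>
proof (induction "nat (\<Sum>k\<le>n. (\<Sum>j<k. \<Sum>i\<le>n. C i j) - (\<Sum>j<k. u j))" arbitrary: C rule: less_induct)
  case less
  define w where "w j = (\<Sum>i\<le>n. C i j)" for j
  define D where "D k = (\<Sum>j<k. w j) - (\<Sum>j<k. u j)" for k
  have D0: "D 0 = 0" and Dn: "D n = 0" and Dnn: "\<And>k. k \<le> n \<Longrightarrow> 0 \<le> D k"
    and DS: "\<And>k. D (Suc k) = D k + w k - u k"
    using less.prems by (auto simp: D_def w_def)
  show ?case
  proof (cases "\<exists>k\<le>n. D k > 0")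
    case False
    then have "\<And>k. k \<le> n \<Longrightarrow> D k = 0" using Dnn by (meson linorder_not_le order_antisym)
    then have "w j = u j" if "j < n" for j
      using DS[of j] that by simp
    then show ?thesis using less.prems(1) by (auto simp: w_def)
  next
    case True
    define s where "s = (LEAST k. D k > 0)"
    have s: "D s > 0" "s \<le> n"
      unfolding s_def using True by (auto intro: LeastI Least_le order_trans)
    have below_s: "\<not> D k > 0" if "k < s" for k
      using not_less_Least that unfolding s_def by blast
    obtain p where p: "s = Suc p" using s D0 by (cases s) auto
    have wp: "w p > u p" using DS[of p] s p below_s[of p] by simp
    define t where "t = (LEAST k. s \<le> k \<and> D k \<le> 0)"
    have "s \<le> n \<and> D n \<le> 0" using s Dn by simp
    then have t: "s \<le> t" "D t \<le> 0" "t \<le> n"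
      unfolding t_def by (metis (mono_tags, lifting) LeastI Least_le)+
    have below_t: "D k > 0" if "s \<le> k" "k < t" for k
      using not_less_Least[of k "\<lambda>k. s \<le> k \<and> D k \<le> 0"] that unfolding t_def by auto
    have "t \<noteq> s" using s t by auto
    then obtain q where q: "t = Suc q" "s \<le> q" using t by (cases t) auto
    have wq: "w q < u q" using DS[of q] q t below_t[of q] by simp
    have pq: "p < q" "q < n" "p < n" using p q t by auto
    have "w q < w p" using wp wq anti[of p q] pq by simp
    then obtain C' where C': "binary_rows n C'"
      "\<And>j. (\<Sum>i\<le>n. C' i j) = w j + (of_bool (j = q) - of_bool (j = p))"
      using binary_rows_exchange[OF less.prems(1) pq(3,2)] unfolding w_def by metis
    \<comment> \<open>Only the prefixes that contain \<open>p\<close> but not \<open>q\<close> lose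
      a one. For them \<open>s \<le> k < t\<close>, where the excess \<open>D k\<close> is positive,
      so domination survives the move.\<close>
    have pre: "(\<Sum>j<k. \<Sum>i\<le>n. C' i j) - (\<Sum>j<k. u j) = D k - of_bool (p < k \<and> k \<le> q)" for k
    proof -
      have "(\<Sum>j<k. \<Sum>i\<le>n. C' i j)
          = (\<Sum>j<k. w j) + ((\<Sum>j<k. of_bool (j = q)) - (\<Sum>j<k. of_bool (j = p)))"
        by (simp only: C'(2) sum.distrib sum_subtractf)
      also have "(\<Sum>j<k. of_bool (j = q)) = (of_bool (q < k) :: int)" by (simp add: of_bool_def)
      also have "(\<Sum>j<k. of_bool (j = p)) = (of_bool (p < k) :: int)" by (simp add: of_bool_def)
      finally show ?thesis using pq by (auto simp: D_def)
    qed
    have ge: "D k - of_bool (p < k \<and> k \<le> q) \<ge> 0" if "k \<le> n" for k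
      using below_t[of k] Dnn[OF that] p q by auto
    have "(\<Sum>k\<le>n. D k - of_bool (p < k \<and> k \<le> q)) < (\<Sum>k\<le>n. D k)"
      by (rule sum_strict_mono_ex1) (use pq in \<open>auto intro!: bexI[of _ q]\<close>)
    moreover have "(\<Sum>k\<le>n. D k - of_bool (p < k \<and> k \<le> q)) \<ge> 0"
      using ge by (intro sum_nonneg) auto
    ultimately have "nat (\<Sum>k\<le>n. (\<Sum>j<k. \<Sum>i\<le>n. C' i j) - (\<Sum>j<k. u j))
        < nat (\<Sum>k\<le>n. (\<Sum>j<k. \<Sum>i\<le>n. C i j) - (\<Sum>j<k. u j))"
      unfolding pre by (simp add: D_def w_def)
    then show ?thesis
    proof (rule less.hyps)
      show "binary_rows n C'" by (fact C')
      show "(\<Sum>j<k. u j) \<le> (\<Sum>j<k. \<Sum>i\<le>n. C' i j)" if "k \<le> n" for k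
        using pre[of k] ge[OF that] by simp
      show "(\<Sum>j<n. u j) = (\<Sum>j<n. \<Sum>i\<le>n. C' i j)"
        using pre[of n] Dn pq by simp
    qed
  qed
qed

lemma binary_rows_exists:
  fixes u :: "nat \<Rightarrow> int"
  assumes "\<And>i j. i \<le> j \<Longrightarrow> j < n \<Longrightarrow> u j \<le> u i"
    and "\<And>k. k \<le> n \<Longrightarrow> (\<Sum>j<k. u j) \<le> (\<Sum>j<k. int n - int j)"
    and "(\<Sum>j<n. u j) = (\<Sum>j<n. int n - int j)"
  obtains C where "binary_rows n C" "\<And>j. j < n \<Longrightarrow> (\<Sum>i\<le>n. C i j) = u j"
proof -
  \<comment> \<open>The triangular choice has column sums \<open>n, n - 1, ..., 1\<close>, so the
    domination required by \<open>binary_rows_reach\<close> is exactly the majorization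
    bound.\<close>
  define C :: "nat \<Rightarrow> nat \<Rightarrow> int" where "C i j = of_bool (j < i)" for i j
  have "(\<Sum>j<n. C i j) = int i" if "i \<le> n" for i
  proof -
    have "{..<n} \<inter> {j. j < i} = {..<i}" using that by auto
    then show ?thesis by (simp add: C_def of_bool_def sum.If_cases)
  qed
  then have "binary_rows n C" by (auto simp: binary_rows_def C_def)
  moreover have col: "(\<Sum>i\<le>n. C i j) = int n - int j" if "j < n" for j
  proof -
    have "{..n} \<inter> {i. j < i} = {j<..n}" by auto
    then show ?thesis using that by (simp add: C_def of_bool_def sum.If_cases)
  qed
  moreover have "(\<Sum>j<k. \<Sum>i\<le>n. C i j) = (\<Sum>j<k. int n - int j)" if "k \<le> n" for k
    using that col by (intro sum.cong) auto
  ultimately show thesis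
    using binary_rows_reach[of n u C] assms that by auto
qed

section \<open>Interlacing the rows by averaging\<close>

text \<open>\<open>H i j\<close> stands for the sum of the top left \<open>i \<times> j\<close> block of a matrix.\<close>

definition corner_sums :: "nat \<Rightarrow> (nat \<Rightarrow> nat \<Rightarrow> int) \<Rightarrow> bool" where
  "corner_sums n H \<longleftrightarrow>
     (\<forall>i\<le>n. H i 0 = 0 \<and> H i n = int i \<and> (\<forall>j<n. H i (Suc j) - H i j \<in> {0, 1}))"

text \<open>For \<open>s\<close> and \<open>t\<close> the sums of two rows at adjacent columns, this
  keeps the horizontal steps of the averaged row in {0, 1}. Adding 1 to both covers rounding
  up.\<close>

lemma div2_step:
  fixes s t :: int
  assumes "s - t \<in> {0, 1, 2}"
  shows "s div 2 - t div 2 \<in> {0, 1}"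
proof -
  have "t div 2 \<le> s div 2" "s div 2 \<le> t div 2 + 1" using assms by auto
  then show ?thesis by auto
qed

lemma div2_sum: "s div 2 + (s + 1) div 2 = s" for s :: int
  by presburger

lemma div2_diff: "(s + 1) div 2 - s div 2 = 0 \<or> (s + 1) div 2 - s div 2 = 1" for s :: int
  by presburger

text \<open>Averaging two consecutive rows keeps their sum, and decreases the energy
  \<open>\<Sum>i j. (2 * H i j - i)\<^sup>2\<close> unless the rows already differ by \<open>0\<close> or \<open>1\<close> everywhere.\<close>

lemma corner_sums_interlace:
  assumes "corner_sums n H"
  shows "\<exists>H'. corner_sums n H' \<and> (\<forall>j. (\<Sum>i\<le>n. H' i j) = (\<Sum>i\<le>n. H i j)) \<and>
    (\<forall>i<n. \<forall>j\<le>n. H' (Suc i) j - H' i j \<in> {0, 1})"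
  using assms
proof (induction "nat (\<Sum>i\<le>n. \<Sum>j\<le>n. (2 * H i j - int i)\<^sup>2)" arbitrary: H rule: less_induct)
  case less
  show ?case
  proof (cases "\<forall>i<n. \<forall>j\<le>n. H (Suc i) j - H i j \<in> {0, 1}")
    case True
    with less.prems show ?thesis by blast
  next
    case False
    then obtain r c where rc: "r < n" "c \<le> n" "H (Suc r) c - H r c \<notin> {0, 1}" by blast
    \<comment> \<open>Rounding down in row \<open>r\<close> and up in row \<open>r + 1\<close> also
      preserves the last entries: they sum to \<open>2 r + 1\<close>, whose halves round to
      \<open>r\<close> and \<open>r + 1\<close>.\<close>
    define K where "K = H(r := \<lambda>j. (H r j + H (Suc r) j) div 2,
      Suc r := \<lambda>j. (H r j + H (Suc r) j + 1) div 2)"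
    have K: "K r j = (H r j + H (Suc r) j) div 2" "K (Suc r) j = (H r j + H (Suc r) j + 1) div 2"
      "i \<noteq> r \<Longrightarrow> i \<noteq> Suc r \<Longrightarrow> K i j = H i j" for i j
      by (auto simp: K_def)
    have split: "(\<Sum>i\<le>n. f i) = (\<Sum>i\<in>{..n} - {r, Suc r}. f i) + (f r + f (Suc r))"
      for f :: "nat \<Rightarrow> int"
      using rc sum.subset_diff[of "{r, Suc r}" "{..n}" f] by simp
    have cs: "corner_sums n K"
      unfolding corner_sums_def
    proof (intro allI impI)
      fix i assume i: "i \<le> n"
      consider "i = r" | "i = Suc r" | "i \<noteq> r" "i \<noteq> Suc r" by blast
      then show "K i 0 = 0 \<and> K i n = int i \<and> (\<forall>j<n. K i (Suc j) - K i j \<in> {0, 1})"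
      proof cases
        case 3
        then show ?thesis using less.prems i by (simp add: K corner_sums_def)
      next
        case 1
        have "K r (Suc j) - K r j \<in> {0, 1}" if "j < n" for j
        proof -
          have "H r (Suc j) - H r j \<in> {0, 1}" "H (Suc r) (Suc j) - H (Suc r) j \<in> {0, 1}"
            using less.prems rc(1) that by (auto simp: corner_sums_def)
          then show ?thesis unfolding K by (intro div2_step) auto
        qed
        with 1 show ?thesis using less.prems rc(1) by (simp add: K corner_sums_def)
      next
        case 2
        have "K (Suc r) (Suc j) - K (Suc r) j \<in> {0, 1}" if "j < n" for j
        proof -
          have "H r (Suc j) - H r j \<in> {0, 1}" "H (Suc r) (Suc j) - H (Suc r) j \<in> {0, 1}"
            using less.prems rc(1) that by (auto simp: corner_sums_def)
          then show ?thesis unfolding K by (intro div2_step) auto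
        qed
        with 2 show ?thesis using less.prems rc(1) by (simp add: K corner_sums_def)
      qed
    qed
    have sum_eq: "K r j + K (Suc r) j = H r j + H (Suc r) j" for j using div2_sum K by simp
    have sums: "(\<Sum>i\<le>n. K i j) = (\<Sum>i\<le>n. H i j)" for j
    proof -
      show ?thesis unfolding split sum_eq by (simp add: K)
    qed
    define E where "E F j = (2 * F r j - int r)\<^sup>2 + (2 * F (Suc r) j - int (Suc r))\<^sup>2"
      for F :: "nat \<Rightarrow> nat \<Rightarrow> int" and j
    \<comment> \<open>The identity 2(a^2 + b^2) = (a + b)^2 + (b - a)^2. The first square depends
      only on the sum of the two rows, which averaging keeps. The second is the square of an odd
      number, minimal exactly when the rows differ by 0 or 1; the centering at \<open>i\<close> in
      the energy makes these two differences tie.\<close>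
    have E: "2 * E F j = (2 * (F r j + F (Suc r) j) - 2 * int r - 1)\<^sup>2
        + (2 * (F (Suc r) j - F r j) - 1)\<^sup>2" for F j
      by (simp add: E_def power2_eq_square algebra_simps)
    have diff01: "K (Suc r) j - K r j = 0 \<or> K (Suc r) j - K r j = 1" for j
      using div2_diff[of "H r j + H (Suc r) j"] K by simp
    have sq1: "(2 * (K (Suc r) j - K r j) - 1)\<^sup>2 = 1" for j
      using diff01[of j] by (elim disjE) (simp_all only: right_diff_distrib[symmetric], simp_all)
    have odd_sq: "1 \<le> (2 * x - 1)\<^sup>2" for x :: int
    proof -
      have "2 * x - 1 \<noteq> 0" by presburger
      then have "0 < (2 * x - 1)\<^sup>2" by simp
      then show ?thesis by linarith
    qed
    have le: "E K j \<le> E H j" for j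
      using E[of K j] E[of H j] sum_eq[of j] sq1[of j] odd_sq[of "H (Suc r) j - H r j"] by simp
    have lt: "E K c < E H c"
    proof -
      define x where "x = H (Suc r) c - H r c"
      have "2 \<le> \<bar>2 * x - 1\<bar>" using rc(3) unfolding x_def[symmetric] by auto
      then have "2\<^sup>2 \<le> (2 * x - 1)\<^sup>2" using abs_le_square_iff[of 2 "2 * x - 1"] by simp
      then show ?thesis
        using E[of K c] E[of H c] sum_eq[of c] sq1[of c] unfolding x_def by simp
    qed
    have en: "(\<Sum>i\<le>n. \<Sum>j\<le>n. (2 * F i j - int i)\<^sup>2)
        = (\<Sum>i\<in>{..n} - {r, Suc r}. \<Sum>j\<le>n. (2 * F i j - int i)\<^sup>2) + (\<Sum>j\<le>n. E F j)" for F
      unfolding split E_def sum.distrib by simp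
    have "(\<Sum>j\<le>n. E K j) < (\<Sum>j\<le>n. E H j)"
      by (rule sum_strict_mono_ex1) (use le lt rc in auto)
    then have "(\<Sum>i\<le>n. \<Sum>j\<le>n. (2 * K i j - int i)\<^sup>2) < (\<Sum>i\<le>n. \<Sum>j\<le>n. (2 * H i j - int i)\<^sup>2)"
      unfolding en by (simp add: K)
    moreover have "0 \<le> (\<Sum>i\<le>n. \<Sum>j\<le>n. (2 * K i j - int i)\<^sup>2)"
      by (intro sum_nonneg) auto
    ultimately have "nat (\<Sum>i\<le>n. \<Sum>j\<le>n. (2 * K i j - int i)\<^sup>2)
        < nat (\<Sum>i\<le>n. \<Sum>j\<le>n. (2 * H i j - int i)\<^sup>2)" by linarith
    from less.hyps[OF this cs] show ?thesis unfolding sums .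
  qed
qed

section \<open>Alternation and prefix sums\<close>

text \<open>Neighbours cancel in pairs, leaving nothing or, for odd length, one copy of the first
  entry.\<close>

lemma sum_alternating_list:
  fixes ys :: "int list"
  assumes "successively (\<lambda>a b. sgn b = - sgn a) ys" "set ys \<subseteq> {1, -1}" "ys \<noteq> []"
  shows "sum_list ys \<in> {0, hd ys}"
  using assms
proof (induction ys)
  case (Cons a ys)
  show ?case
  proof (cases ys)
    case (Cons b zs)
    then have "b = - a" using Cons.prems by auto
    then show ?thesis using Cons Cons.IH Cons.prems by auto
  qed simp
qed simp

lemma sum_list_filter_nonzero:
  fixes xs :: "'a::monoid_add list"
  shows "sum_list (filter (\<lambda>a. a \<noteq> 0) xs) = sum_list xs"
  by (induction xs) auto

text \<open>The total 1 forces the first nonzero entry to be 1. The nonzero entries of a prefix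
  either are absent or alternate from that same entry.\<close>

lemma alternating_take:
  fixes xs :: "int list"
  assumes alt: "successively (\<lambda>a b. sgn b = - sgn a) (filter (\<lambda>a. a \<noteq> 0) xs)"
    and ent: "set xs \<subseteq> {0, 1, -1}" and one: "sum_list xs = 1"
  shows "sum_list (take k xs) \<in> {0, 1}"
proof -
  let ?f = "filter (\<lambda>a::int. a \<noteq> 0)"
  have eq: "?f xs = ?f (take k xs) @ ?f (drop k xs)"
    by (metis append_take_drop_id filter_append)
  have ne: "?f xs \<noteq> []" using one sum_list_filter_nonzero[of xs] by force
  have "sum_list (?f xs) \<in> {0, hd (?f xs)}"
    by (rule sum_alternating_list[OF alt _ ne]) (use ent in auto)
  then have hd1: "hd (?f xs) = 1" using one by (simp add: sum_list_filter_nonzero)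
  show ?thesis
  proof (cases "?f (take k xs) = []")
    case True
    then show ?thesis by (metis insertI1 sum_list.Nil sum_list_filter_nonzero)
  next
    case False
    have "sum_list (?f (take k xs)) \<in> {0, hd (?f (take k xs))}"
    proof (rule sum_alternating_list[OF _ _ False])
      show "successively (\<lambda>a b. sgn b = - sgn a) (?f (take k xs))"
        using alt unfolding eq by (simp add: successively_append_iff)
      show "set (?f (take k xs)) \<subseteq> {1, -1}" using ent set_take_subset[of k xs] by auto
    qed
    then show ?thesis using hd1 False unfolding eq by (simp add: sum_list_filter_nonzero)
  qed
qed

text \<open>The offset \<open>s\<close> is the sum of the entries already read. From 0 the next
  nonzero entry can only be 1, from 1 only -1, hence \<open>1 - 2 * s\<close>; this claim about the
  head carries the induction.\<close>

lemma alternating_of_prefix_sums: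
  fixes xs :: "int list"
  assumes "\<And>k. k \<le> length xs \<Longrightarrow> s + sum_list (take k xs) \<in> {0, 1}"
  shows "successively (\<lambda>a b. sgn b = - sgn a) (filter (\<lambda>a. a \<noteq> 0) xs) \<and>
    (filter (\<lambda>a. a \<noteq> 0) xs \<noteq> [] \<longrightarrow> hd (filter (\<lambda>a. a \<noteq> 0) xs) = 1 - 2 * s)"
  using assms
proof (induction xs arbitrary: s)
  case (Cons x xs)
  have s: "s \<in> {0, 1}" "s + x \<in> {0, 1}"
    using Cons.prems[of 0] Cons.prems[of 1] by auto
  have "s + x + sum_list (take k xs) \<in> {0, 1}" if "k \<le> length xs" for k
    using Cons.prems[of "Suc k"] that by (simp add: add.assoc)
  from Cons.IH[OF this] show ?case
    using s by (auto simp: successively_Cons)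
qed simp

lemma sum_list_take_list_of_vec:
  fixes u :: "'a::comm_monoid_add vec"
  assumes "k \<le> dim_vec u"
  shows "sum_list (take k (list_of_vec u)) = (\<Sum>i<k. u $ i)"
proof -
  have "sum_list (take k (list_of_vec u)) = (\<Sum>i = 0..<k. take k (list_of_vec u) ! i)"
    using assms by (simp add: sum_list_sum_nth)
  also have "\<dots> = (\<Sum>i<k. u $ i)"
    using assms by (intro sum.cong) (auto simp: list_of_vec_index)
  finally show ?thesis .
qed

lemma alternating_sum_one_sum:
  assumes "alternating_sum_one u"
  shows "(\<Sum>i<dim_vec u. u $ i) = 1"
  using assms sum_list_take_list_of_vec[of "dim_vec u" u]
  by (simp add: alternating_sum_one_def nonzero_entries_def sum_list_filter_nonzero)

lemma alternating_sum_one_prefix: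
  assumes "alternating_sum_one u" and "k \<le> dim_vec u"
    and "\<And>i. i < dim_vec u \<Longrightarrow> u $ i \<in> {0, 1, -1}"
  shows "(\<Sum>i<k. u $ i) \<in> {0, 1}"
proof -
  have "set (list_of_vec u) \<subseteq> {0, 1, -1}"
    using assms(3) by (auto simp: set_list_of_vec vec_set_def)
  then show ?thesis
    using alternating_take[of "list_of_vec u" k] assms(1,2) sum_list_take_list_of_vec[OF assms(2)]
    by (simp add: alternating_sum_one_def nonzero_entries_def sum_list_filter_nonzero)
qed

lemma alternating_sum_oneI:
  assumes "\<And>k. k \<le> dim_vec u \<Longrightarrow> (\<Sum>i<k. u $ i) \<in> {0, 1}"
    and "(\<Sum>i<dim_vec u. u $ i) = 1"
  shows "alternating_sum_one u"
proof -
  have "successively (\<lambda>a b. sgn b = - sgn a) (filter (\<lambda>a. a \<noteq> 0) (list_of_vec u))"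
    using alternating_of_prefix_sums[of "list_of_vec u" 0] assms(1)
    by (simp add: sum_list_take_list_of_vec)
  then show ?thesis
    using assms(2) sum_list_take_list_of_vec[of "dim_vec u" u]
    by (simp add: alternating_sum_one_def nonzero_entries_def sum_list_filter_nonzero)
qed

section \<open>Matrices, their partial sums and their projections\<close>

text \<open>The term \<open>a r\<close> occurs in the partial sums with
  \<open>r < i \<le> n\<close>, that is, \<open>n - r\<close> times.\<close>

lemma sum_partial_sums:
  fixes a :: "nat \<Rightarrow> int"
  shows "(\<Sum>i\<le>n. \<Sum>r<i. a r) = (\<Sum>r<n. (int n - int r) * a r)"
proof (induction n)
  case (Suc n)
  have "(\<Sum>r<Suc n. (int (Suc n) - int r) * a r) = (\<Sum>r<Suc n. (int n - int r) * a r + a r)"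
    by (intro sum.cong) (auto simp: algebra_simps)
  also have "\<dots> = (\<Sum>r<n. (int n - int r) * a r) + (\<Sum>r<Suc n. a r)"
    by (simp add: sum.distrib)
  finally show ?case using Suc by simp
qed simp

lemma weighted_projection_index:
  assumes "A \<in> carrier_mat n n" "j < n"
  shows "weighted_projection A $ j = (\<Sum>i\<le>n. \<Sum>r<i. A $$ (r, j))"
proof -
  have "weighted_projection A $ j = (\<Sum>r<n. (int n - int r) * A $$ (r, j))"
    using assms
    by (auto simp: weighted_projection_def zvec_def scalar_prod_def lessThan_atLeast0
        intro!: sum.cong)
  then show ?thesis by (simp add: sum_partial_sums)
qed

text \<open>The entries are prefix sums of alternating columns, and each of the first
  \<open>i\<close> rows of \<open>A\<close> contributes 1 to the row total.\<close>

lemma asm_partial_sums: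
  assumes "alternating_sign_matrix n A"
  shows "binary_rows n (\<lambda>i j. \<Sum>r<i. A $$ (r, j))"
proof -
  have A: "A \<in> carrier_mat n n" using assms by (simp add: alternating_sign_matrix_def)
  have "(\<Sum>r<i. A $$ (r, j)) \<in> {0, 1}" if "i \<le> n" "j < n" for i j
    using alternating_sum_one_prefix[of "col A j" i] assms that A
    by (simp add: alternating_sign_matrix_def)
  moreover have "(\<Sum>j<n. \<Sum>r<i. A $$ (r, j)) = int i" if "i \<le> n" for i
  proof -
    have "(\<Sum>j<n. A $$ (r, j)) = 1" if "r < n" for r
      using alternating_sum_one_sum[of "row A r"] assms that A
      by (simp add: alternating_sign_matrix_def)
    then show ?thesis using that by (subst sum.swap) simp
  qed
  ultimately show ?thesis by (simp add: binary_rows_def)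
qed

text \<open>The mixed second differences of \<open>H\<close> form the matrix. Its row prefix sums
  are vertical differences of \<open>H\<close> and its column prefix sums horizontal ones; all are 0
  or 1, which is alternation.\<close>

lemma asm_of_corner_sums:
  assumes H: "corner_sums n H"
    and inter: "\<And>i j. i < n \<Longrightarrow> j \<le> n \<Longrightarrow> H (Suc i) j - H i j \<in> {0, 1}"
    and j: "\<And>j. j < n \<Longrightarrow> (\<Sum>i\<le>n. H i (Suc j) - H i j) = v $ j"
    and v: "v \<in> carrier_vec n"
  obtains A where "alternating_sign_matrix n A" "weighted_projection A = v"
proof
  define A where "A = mat n n (\<lambda>(i, j). H (Suc i) (Suc j) - H i (Suc j) - (H (Suc i) j - H i j))"
  have A: "A \<in> carrier_mat n n" by (simp add: A_def)
  have col_step: "H i (Suc j) - H i j \<in> {0, 1}" if "i \<le> n" "j < n" for i j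
    using H that by (simp add: corner_sums_def)
  have Hn: "H i n = int i" and H0: "H i 0 = 0" if "i \<le> n" for i
    using H that by (auto simp: corner_sums_def)
  have mono: "H i j \<le> H i (Suc j)" if "i \<le> n" "j < n" for i j
    using col_step[OF that] by auto
  \<comment> \<open>Row 0 is nondecreasing and squeezed between \<open>H 0 0 = 0\<close> and
    \<open>H 0 n = 0\<close>.\<close>
  have zero_row: "H 0 j = 0" if "j \<le> n" for j
  proof -
    have "H 0 0 \<le> H 0 j"
      using that
    proof (induction j)
      case (Suc j) then show ?case using mono[of 0 j] by simp
    qed simp
    moreover have "H 0 j \<le> H 0 n"
      using that
    proof (induction j rule: inc_induct)
      case (step m) then show ?case using mono[of 0 m] by simp
    qed simp
    ultimately show ?thesis using Hn[of 0] H0[of 0] by simp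
  qed
  \<comment> \<open>Row \<open>n\<close> climbs from 0 to \<open>n\<close> in \<open>n\<close> steps
    of at most 1, so every step is 1. Hence every column of the matrix sums to 1.\<close>
  have last_row: "H n j = int j" if "j \<le> n" for j
  proof -
    have "H n j \<le> int j"
      using that
    proof (induction j)
      case (Suc j) then show ?case using col_step[of n j] by auto
    qed (simp add: H0)
    moreover have "H n j \<ge> int j"
      using that
    proof (induction j rule: inc_induct)
      case (step m) then show ?case using col_step[of n m]
        by auto
    qed (simp add: Hn)
    ultimately show ?thesis by simp
  qed
  have rowp: "(\<Sum>c<k. A $$ (i, c)) = H (Suc i) k - H i k" if "i < n" "k \<le> n" for i k
    using that
  proof (induction k)
    case (Suc k) then show ?case by (simp add: A_def)
  qed (simp add: H0)
  have colp: "(\<Sum>r<k. A $$ (r, j)) = H k (Suc j) - H k j" if "j < n" "k \<le> n" for j k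
    using that
  proof (induction k)
    case (Suc k) then show ?case by (simp add: A_def)
  qed (simp add: zero_row)
  show "alternating_sign_matrix n A"
    unfolding alternating_sign_matrix_def
  proof (intro conjI allI impI)
    fix i j assume "i < n" "j < n"
    then show "A $$ (i, j) \<in> {0, 1, -1}"
      using inter[of i j] inter[of i "Suc j"] by (auto simp: A_def)
  next
    fix i assume "i < n"
    then show "alternating_sum_one (row A i)"
      using rowp[of i] inter[of i] Hn A by (intro alternating_sum_oneI) auto
  next
    fix j assume "j < n"
    then show "alternating_sum_one (col A j)"
      using colp[of j] col_step[of _ j] last_row A by (intro alternating_sum_oneI) auto
  qed (fact A)
  show "weighted_projection A = v"
  proof (rule eq_vecI)
    show "dim_vec (weighted_projection A) = dim_vec v"
      using A v by (simp add: weighted_projection_def)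
    fix c assume "c < dim_vec v"
    then show "weighted_projection A $ c = v $ c"
      using A v colp[of c] j[of c] by (simp add: weighted_projection_index)
  qed
qed

section \<open>Majorization by \<open>zvec n\<close>\<close>

lemma decreasing_entries_zvec:
  assumes "i < n"
  shows "decreasing_entries (zvec n) ! i = int n - int i"
proof -
  let ?xs = "map (\<lambda>i. int n - int i) [0..<n]"
  have "sorted (rev ?xs)"
    by (auto simp: sorted_iff_nth_mono rev_nth)
  then have "sort ?xs = rev ?xs"
    by (intro properties_for_sort) simp_all
  moreover have "list_of_vec (zvec n) = ?xs"
    by (rule nth_equalityI) (auto simp: zvec_def list_of_vec_index)
  ultimately show ?thesis using assms by (simp add: decreasing_entries_def)
qed

lemma decreasing_entries_permutation:
  assumes "v \<in> carrier_vec n"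
  obtains p where "p permutes {..<n}" "\<And>i. i < n \<Longrightarrow> decreasing_entries v ! i = v $ p i"
proof -
  have "mset (decreasing_entries v) = mset (list_of_vec v)" by (simp add: decreasing_entries_def)
  then obtain p where p: "p permutes {..<length (list_of_vec v)}"
    "permute_list p (list_of_vec v) = decreasing_entries v"
    by (rule mset_eq_permutation)
  show thesis
  proof
    show perm: "p permutes {..<n}" using p assms by simp
    fix i assume i: "i < n"
    then have "p i < n" using permutes_in_image[OF perm] by auto
    then show "decreasing_entries v ! i = v $ p i"
      using p i assms by (auto simp: permute_list_nth list_of_vec_index simp flip: p(2))
  qed
qed

lemma decreasing_entries_antimono:
  assumes "i \<le> j" "j < dim_vec v"
  shows "decreasing_entries v ! j \<le> decreasing_entries v ! i"
  using assms by (auto simp: decreasing_entries_def rev_nth intro!: sorted_nth_mono)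

lemma majorized_zvec_iff:
  assumes "v \<in> carrier_vec n"
  shows "v \<preceq>\<^sub>m zvec n \<longleftrightarrow>
    (\<forall>k\<le>n. (\<Sum>i<k. decreasing_entries v ! i) \<le> (\<Sum>i<k. int n - int i)) \<and>
    (\<Sum>i<n. decreasing_entries v ! i) = (\<Sum>i<n. int n - int i)"
proof -
  have z: "(\<Sum>i<k. decreasing_entries (zvec n) ! i) = (\<Sum>i<k. int n - int i)" if "k \<le> n" for k
    using that by (intro sum.cong) (auto simp: decreasing_entries_zvec)
  have "dim_vec v = n" "dim_vec (zvec n) = n" using assms by (auto simp: zvec_def)
  \<comment> \<open>The case \<open>k = 0\<close> may be added because both sums are then
    empty.\<close>
  moreover have range: "(\<forall>k\<in>{1..n}. P k) \<longleftrightarrow> (\<forall>k\<le>n. P k)" if "P 0" for P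
    using that by (metis One_nat_def Suc_leI atLeastAtMost_iff gr0I)
  moreover note range[of "\<lambda>k. (\<Sum>i<k. decreasing_entries v ! i) \<le> (\<Sum>i<k. int n - int i)"]
  ultimately show ?thesis unfolding majorized_def using z by simp
qed

section \<open>The two directions of the equivalence\<close>

lemma asm_majorized:
  assumes A: "alternating_sign_matrix n A"
  shows "weighted_projection A \<preceq>\<^sub>m zvec n"
proof -
  let ?v = "weighted_projection A"
  have cA: "A \<in> carrier_mat n n" using A by (simp add: alternating_sign_matrix_def)
  then have v: "?v \<in> carrier_vec n" by (intro carrier_vecI) (simp add: weighted_projection_def)
  define C where "C i j = (\<Sum>r<i. A $$ (r, j))" for i j
  have C: "binary_rows n C" using asm_partial_sums[OF A] by (simp add: C_def[abs_def])
  obtain p where p: "p permutes {..<n}" "\<And>i. i < n \<Longrightarrow> decreasing_entries ?v ! i = ?v $ p i"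
    using decreasing_entries_permutation[OF v] by blast
  have pn: "p l < n" if "l < n" for l using permutes_in_image[OF p(1)] that by auto
  \<comment> \<open>The \<open>k\<close> largest entries of the projection count the ones of
    \<open>C\<close> in the columns \<open>p 0, ..., p (k - 1)\<close>; the count is regrouped by
    rows.\<close>
  have eq: "(\<Sum>l<k. decreasing_entries ?v ! l) = (\<Sum>i\<le>n. \<Sum>l<k. C i (p l))" if "k \<le> n" for k
    using that cA pn by (subst sum.swap) (auto simp: p(2) weighted_projection_index C_def)
  have row: "(\<Sum>l<n. C i (p l)) = int i" if "i \<le> n" for i
    using sum.permute[OF p(1), of "C i"] C that by (simp add: binary_rows_def comp_def)
  have C01: "0 \<le> C i (p l) \<and> C i (p l) \<le> 1" if "i \<le> n" "l < n" for i l
    using C that pn[of l] unfolding binary_rows_def by fastforce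
  have "(\<Sum>l<k. C i (p l)) \<le> min (int i) (int k)" if "i \<le> n" "k \<le> n" for i k
  proof -
    have "(\<Sum>l<k. C i (p l)) \<le> (\<Sum>l<n. C i (p l))"
      by (rule sum_mono2) (use C01 that in auto)
    moreover have "(\<Sum>l<k. C i (p l)) \<le> (\<Sum>l<k. 1)"
      by (rule sum_mono) (use C01 that in auto)
    ultimately show ?thesis using row that by simp
  qed
  then have "(\<Sum>l<k. decreasing_entries ?v ! l) \<le> (\<Sum>l<k. int n - int l)" if "k \<le> n" for k
    unfolding eq[OF that] sum_min_eq[OF that, symmetric] using that by (intro sum_mono) auto
  \<comment> \<open>For \<open>k = n\<close> row \<open>i\<close> contributes all of its
    \<open>i\<close> ones, and \<open>min i n = i\<close>, so the bound is attained.\<close>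
  moreover have "(\<Sum>l<n. decreasing_entries ?v ! l) = (\<Sum>l<n. int n - int l)"
    unfolding eq[OF order_refl] sum_min_eq[OF order_refl, symmetric]
    by (intro sum.cong) (auto simp: row)
  ultimately show ?thesis using v by (simp add: majorized_zvec_iff)
qed

lemma asm_of_majorized:
  assumes v: "v \<in> carrier_vec n" and maj: "v \<preceq>\<^sub>m zvec n"
  obtains A where "alternating_sign_matrix n A" "weighted_projection A = v"
proof -
  obtain p where p: "p permutes {..<n}" "\<And>i. i < n \<Longrightarrow> decreasing_entries v ! i = v $ p i"
    using decreasing_entries_permutation[OF v] by blast
  obtain C where C: "binary_rows n C"
    "\<And>j. j < n \<Longrightarrow> (\<Sum>i\<le>n. C i j) = decreasing_entries v ! j"
    using binary_rows_exists[of n "(!) (decreasing_entries v)"]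
      decreasing_entries_antimono[of _ _ v] maj v by (auto simp: majorized_zvec_iff)
  \<comment> \<open>The columns of \<open>C\<close> follow the sorted order of \<open>v\<close>.
    Placing column \<open>?q c\<close> of \<open>C\<close> at position \<open>c\<close> restores the
    original order, since \<open>p (?q c) = c\<close>.\<close>
  let ?q = "Hilbert_Choice.inv p"
  have q: "?q permutes {..<n}" using p by (simp add: permutes_inv)
  have qn: "?q j < n" if "j < n" for j using permutes_in_image[OF q] that by auto
  define H where "H i j = (\<Sum>c<j. C i (?q c))" for i j
  have "corner_sums n H"
    unfolding corner_sums_def
  proof (intro allI impI conjI)
    fix i assume i: "i \<le> n"
    show "H i 0 = 0" by (simp add: H_def)
    show "H i n = int i"
      using sum.permute[OF q, of "C i"] C i by (simp add: H_def binary_rows_def comp_def)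
    fix j assume "j < n"
    then show "H i (Suc j) - H i j \<in> {0, 1}"
      using C(1) qn i by (simp add: H_def binary_rows_def)
  qed
  then obtain K where K: "corner_sums n K" "\<And>j. (\<Sum>i\<le>n. K i j) = (\<Sum>i\<le>n. H i j)"
    "\<forall>i<n. \<forall>j\<le>n. K (Suc i) j - K i j \<in> {0, 1}"
    using corner_sums_interlace by blast
  \<comment> \<open>Interlacing changes the rows but keeps the sum over \<open>i\<close> at each
    \<open>j\<close>, so the column sums are still those of the permuted \<open>C\<close>.\<close>
  have "(\<Sum>i\<le>n. K i (Suc j) - K i j) = v $ j" if "j < n" for j
  proof -
    have "(\<Sum>i\<le>n. K i (Suc j) - K i j) = (\<Sum>i\<le>n. H i (Suc j) - H i j)"
      by (simp add: sum_subtractf K)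
    also have "\<dots> = (\<Sum>i\<le>n. C i (?q j))" by (simp add: H_def)
    also have "\<dots> = v $ j"
      using C(2)[OF qn[OF that]] p(2)[OF qn[OF that]] permutes_inverses(1)[OF p(1)] by simp
    finally show ?thesis .
  qed
  with K v asm_of_corner_sums[of n K v] that show thesis by blast
qed

theorem theorem2p7:
  fixes n :: nat and v :: "int vec"
  assumes "n \<ge> 1"
    and "v \<in> carrier_vec n"
    and "\<forall>i<n. v $ i > 0"
  shows "(\<exists>A. alternating_sign_matrix n A \<and> weighted_projection A = v) \<longleftrightarrow> v \<preceq>\<^sub>m zvec n"
  using asm_majorized asm_of_majorized[OF assms(2)] by metis

end
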